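(* For any fixed $\delta\in[0,1/2)$, any randomized Monte Carlo algorithm that gives an $RW\epsilon$-additive approximation to Basic-Summing (with window size $W$ and integer elements in $\{0,1,\dots,R\}$) with probability at least $1-\delta$ requires $\Omega\left(\frac1\epsilon+\log W\right)$ bits of memory for $\frac1{2W}\le\epsilon\le\frac14$, and $\Omega\left(W\log\frac1{W\epsilon}\right)$ bits of memory for $\epsilon\le\frac1{2W}$. (The case $\delta=0$ applies to Las Vegas algorithms.)
   Context: All logarithms are base 2; $W,R\ge1$ are integers and $\epsilon>0$ is real; asymptotics are for $W\to\infty$, with hidden constants independent of $\epsilon$ and $R$ (they may depend on the fixed $\delta$). Basic-Summing: given a stream of integers in $\{0,1,\dots,R\}$ arriving one at a time, maintain the sum $S$ of the last $W$ elements (if fewer than $W$ elements have arrived, of all elements so far). A deterministic algorithm using $m$ bits of memory has at most $2^m$ memory configurations, a fixed initial configuration, and a deterministic transition of configuration upon each arriving element; when queried it outputs a real number $\widehat S$ determined by its current configuration. It is correct on an input stream if $|\widehat S-S|\le RW\epsilon$ at every time instant while reading that stream. A randomized algorithm is a probability distribution over deterministic algorithms, and its memory requirement is the expected number of memory bits of the drawn deterministic algorithm (in the sense of Yao's minimax principle). A Monte Carlo algorithm giving the approximation with probability at least $1-\delta$ is a randomized algorithm that, for every input stream, is correct on it with probability at least $1-\delta$. A Las Vegas algorithm is always correct.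
   Formalization: The second bound is stated for 1/(2RW) ≤ ε ≤ 1/(2W) rather than all ε ≤ 1/(2W): for far smaller ε it fails, since with R = 1 and ε = 2^(-W²) exact window storage needs only W + O(log W) bits, while W log(1/(Wε)) is about W³. *)

theory Defs
  imports "HOL-Probability.Probability"
begin

definition input_stream :: "nat \<Rightarrow> nat list \<Rightarrow> bool" where
  "input_stream R xs \<longleftrightarrow> set xs \<subseteq> {0..R}"

definition window_sum :: "nat \<Rightarrow> nat list \<Rightarrow> nat" where
  "window_sum W xs = sum_list (drop (length xs - W) xs)"

(* The memory configurations of an algorithm with m bits are the bit strings of length m. *)
record summing_alg =
  mem_bits :: nat
  init_config :: "bool list"
  next_config :: "bool list \<Rightarrow> nat \<Rightarrow> bool list"
  answer :: "bool list \<Rightarrow> real"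

definition well_formed :: "nat \<Rightarrow> summing_alg \<Rightarrow> bool" where
  "well_formed R A \<longleftrightarrow>
     length (init_config A) = mem_bits A \<and>
     (\<forall>q x. length q = mem_bits A \<and> x \<in> {0..R} \<longrightarrow> length (next_config A q x) = mem_bits A)"

definition config :: "summing_alg \<Rightarrow> nat list \<Rightarrow> bool list" where
  "config A xs = foldl (next_config A) (init_config A) xs"

(* Queries are made after each arrival; no answer is demanded before the first element. *)
definition correct_on :: "nat \<Rightarrow> nat \<Rightarrow> real \<Rightarrow> summing_alg \<Rightarrow> nat list \<Rightarrow> bool" where
  "correct_on W R \<epsilon> A xs \<longleftrightarrow>
     (\<forall>t\<in>{1..length xs}.
        \<bar>answer A (config A (take t xs)) - real (window_sum W (take t xs))\<bar> \<le> real R * real W * \<epsilon>)"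

(* The sigma-algebra is arbitrary, apart from measurability of the quantities that are measured:
   the memory size here and the correctness events below. *)
definition randomized_alg :: "nat \<Rightarrow> summing_alg measure \<Rightarrow> bool" where
  "randomized_alg R M \<longleftrightarrow>
     prob_space M \<and> (\<forall>A\<in>space M. well_formed R A) \<and> mem_bits \<in> M \<rightarrow>\<^sub>M count_space UNIV"

(* A nonnegative integral, since the Bochner integral would be 0 for an infinite expectation. *)
definition expected_bits :: "summing_alg measure \<Rightarrow> ennreal" where
  "expected_bits M = (\<integral>\<^sup>+ A. of_nat (mem_bits A) \<partial>M)"

definition monte_carlo :: "nat \<Rightarrow> nat \<Rightarrow> real \<Rightarrow> real \<Rightarrow> summing_alg measure \<Rightarrow> bool" where
  "monte_carlo W R \<epsilon> \<delta> M \<longleftrightarrow>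
     randomized_alg R M \<and>
     (\<forall>xs. input_stream R xs \<longrightarrow>
        {A \<in> space M. correct_on W R \<epsilon> A xs} \<in> sets M \<and>
        measure M {A \<in> space M. correct_on W R \<epsilon> A xs} \<ge> 1 - \<delta>)"

definition las_vegas :: "nat \<Rightarrow> nat \<Rightarrow> real \<Rightarrow> summing_alg measure \<Rightarrow> bool" where
  "las_vegas W R \<epsilon> M \<longleftrightarrow>
     randomized_alg R M \<and>
     (\<forall>A\<in>space M. \<forall>xs. input_stream R xs \<longrightarrow> correct_on W R \<epsilon> A xs)"

end

theory Submission
  imports Defs
begin

text \<open>
  Let a family of prefixes be such that, after appending the same block of \<open>W\<close> zeros to all of them,
  the window sums of any two members differ at some instant by more than twice the allowed error.
  A deterministic algorithm that is correct on two of these streams must be in different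
  configurations after the two prefixes, so with \<open>m\<close> bits it is correct on at most \<open>2\<^sup>m\<close> members.
  A randomized algorithm is correct on at least half of the family on average, hence with
  probability at least \<open>1/4\<close> the drawn algorithm is correct on at least a quarter of the family and
  uses at least logarithmically many bits in the size of the family.
  Suitable families are words of constant blocks whose values are multiples of a step \<open>s\<close>, where
  the product of the step and the block length exceeds \<open>2RW\<epsilon>\<close>.

  The term \<open>log W\<close> comes from the single stream \<open>R\<^sup>W 0 0 0 \<dots>\<close>: with fewer than \<open>W/4\<close>
  configurations the algorithm returns to a configuration visited within the first \<open>W/4\<close> zeros over
  and over again, also after all the elements \<open>R\<close> have expired.
\<close>

section \<open>Configurations and answers\<close>

lemma config_append: "config A (xs @ ys) = foldl (next_config A) (config A xs) ys"
  by (simp add: config_def)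

lemma config_append_cong:
  "config A xs = config A ys \<Longrightarrow> config A (xs @ zs) = config A (ys @ zs)"
  by (simp add: config_append)

lemma length_config:
  assumes "well_formed R A" and "input_stream R xs"
  shows "length (config A xs) = mem_bits A"
  using assms(2)
proof (induction xs rule: rev_induct)
  case Nil
  with assms(1) show ?case by (simp add: config_def well_formed_def)
next
  case (snoc x xs)
  with assms(1) show ?case by (auto simp: config_def well_formed_def input_stream_def)
qed

lemma card_configs: "card {q :: bool list. length q = m} = 2 ^ m"
  and finite_configs: "finite {q :: bool list. length q = m}"
  using card_lists_length_eq[of "UNIV :: bool set" m] finite_lists_length_eq[of "UNIV :: bool set" m]
  by simp_all

lemma input_stream_append [simp]:
  "input_stream R (xs @ ys) \<longleftrightarrow> input_stream R xs \<and> input_stream R ys"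
  by (auto simp: input_stream_def)

lemma input_stream_replicate [simp]: "x \<le> R \<Longrightarrow> input_stream R (replicate k x)"
  by (auto simp: input_stream_def)

lemma correct_on_prefix:
  assumes "correct_on W R \<epsilon> A (xs @ ys)" and "xs \<noteq> []"
  shows "\<bar>answer A (config A xs) - real (window_sum W xs)\<bar> \<le> real R * real W * \<epsilon>"
proof -
  have "length xs \<in> {1..length (xs @ ys)}"
    using assms(2) by (cases xs) auto
  then have "\<bar>answer A (config A (take (length xs) (xs @ ys)))
      - real (window_sum W (take (length xs) (xs @ ys)))\<bar> \<le> real R * real W * \<epsilon>"
    using assms(1) unfolding correct_on_def by blast
  then show ?thesis by simp
qed

text \<open>Equal configurations give equal answers, so the triangle inequality applies. The tails
  \<open>xs'\<close> and \<open>ys'\<close> let the prefixes sit inside longer streams; they must be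
  nonempty because no answer is demanded before the first element.\<close>

lemma window_sums_close:
  assumes "correct_on W R \<epsilon> A (xs @ xs')" and "correct_on W R \<epsilon> A (ys @ ys')"
    and "xs \<noteq> []" and "ys \<noteq> []" and "config A xs = config A ys"
  shows "\<bar>real (window_sum W xs) - real (window_sum W ys)\<bar> \<le> 2 * (real R * real W * \<epsilon>)"
  using correct_on_prefix[OF assms(1,3)] correct_on_prefix[OF assms(2,4)] assms(5) by simp

lemma window_sum_append:
  "length ys = W \<Longrightarrow> window_sum W (xs @ ys) = sum_list ys"
  by (simp add: window_sum_def)

section \<open>From many bits with positive probability to many expected bits\<close>

text \<open>A Markov-type bound: the event of probability at least 1/4 forces
  \<open>log 2 N - 2\<close> bits, the 2 being the cost of the factor 4.\<close>

lemma expected_bits_ge: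
  assumes "randomized_alg R M"
    and "1 / 4 \<le> measure M {A \<in> space M. N \<le> 4 * 2 ^ mem_bits A}"
    and "0 < N"
  shows "ennreal ((log 2 (real N) - 2) / 4) \<le> expected_bits M"
proof (cases "log 2 (real N) - 2 \<le> 0")
  \<comment> \<open>\<open>ennreal\<close> sends negative reals to 0.\<close>
  case True
  then show ?thesis by (simp add: ennreal_neg)
next
  case False
  define b where "b = log 2 (real N) - 2"
  have b: "0 \<le> b" using False by (simp add: b_def)
  define T where "T = {A \<in> space M. N \<le> 4 * 2 ^ mem_bits A}"
  interpret prob_space M using assms(1) by (simp add: randomized_alg_def)
  have [measurable]: "mem_bits \<in> M \<rightarrow>\<^sub>M count_space UNIV"
    using assms(1) by (simp add: randomized_alg_def)
  have [measurable]: "T \<in> sets M" unfolding T_def by measurable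
  have bits: "b \<le> real (mem_bits A)" if "A \<in> T" for A
  proof -
    have "real N \<le> 4 * 2 ^ mem_bits A"
      using that unfolding T_def by (simp add: of_nat_le_iff[where 'a = real, symmetric])
    then have "log 2 (real N) \<le> log 2 (2 ^ (mem_bits A + 2))"
      using assms(3) by (subst log_le_cancel_iff) (auto simp: power_add)
    also have "\<dots> = real (mem_bits A + 2)" by (subst log_nat_power) auto
    finally show ?thesis by (simp add: b_def)
  qed
  have "ennreal (b / 4) \<le> ennreal (b * measure M T)"
    using mult_left_mono[OF assms(2) b] by (intro ennreal_leI) (simp add: T_def)
  also have "\<dots> = ennreal b * emeasure M T"
    using b by (simp add: ennreal_mult emeasure_eq_measure)
  also have "\<dots> = (\<integral>\<^sup>+ A. ennreal b * indicator T A \<partial>M)"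
    by (simp add: nn_integral_cmult_indicator)
  also have "\<dots> \<le> (\<integral>\<^sup>+ A. of_nat (mem_bits A) \<partial>M)"
    by (intro nn_integral_mono)
      (auto simp: indicator_def bits ennreal_of_nat_eq_real_of_nat intro!: ennreal_leI)
  finally show ?thesis by (simp add: expected_bits_def b_def)
qed

text \<open>The averaging step in the spirit of Yao: \<open>few\<close> is the bound for
  deterministic algorithms, and it is played against the uniform distribution on
  \<open>I\<close>.\<close>

lemma expected_bits_ge_family:
  fixes f :: "'i \<Rightarrow> nat list"
  assumes mc: "monte_carlo W R \<epsilon> \<delta> M" and "\<delta> \<le> 1 / 2"
    and "finite I" and "I \<noteq> {}" and stream: "\<And>i. i \<in> I \<Longrightarrow> input_stream R (f i)"
    and few: "\<And>A. A \<in> space M \<Longrightarrow> card {i \<in> I. correct_on W R \<epsilon> A (f i)} \<le> 2 ^ mem_bits A"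
  shows "ennreal ((log 2 (real (card I)) - 2) / 4) \<le> expected_bits M"
proof -
  let ?C = "\<lambda>i. {A \<in> space M. correct_on W R \<epsilon> A (f i)}"
  define T where "T = {A \<in> space M. card I \<le> 4 * 2 ^ mem_bits A}"
  have ra: "randomized_alg R M" using mc by (simp add: monte_carlo_def)
  interpret prob_space M using ra by (simp add: randomized_alg_def)
  have [measurable]: "mem_bits \<in> M \<rightarrow>\<^sub>M count_space UNIV"
    using ra by (simp add: randomized_alg_def)
  have T: "T \<in> sets M" unfolding T_def by measurable
  have C: "?C i \<in> sets M" and prob_C: "1 - \<delta> \<le> measure M (?C i)" if "i \<in> I" for i
    using mc stream[OF that] by (auto simp: monte_carlo_def)
  have pos: "0 < card I" using assms(3,4) by (simp add: card_gt_0_iff)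
  have "real (card I) * (1 / 2) = (\<Sum>i\<in>I. 1 / 2)" by simp
  also have "\<dots> \<le> (\<Sum>i\<in>I. measure M (?C i))"
    using prob_C assms(2) by (intro sum_mono) force
  also have "\<dots> = (\<Sum>i\<in>I. \<integral>A. indicator (?C i) A \<partial>M)"
    using C by (intro sum.cong) (auto simp: measure_def[symmetric])
  also have "\<dots> = (\<integral>A. (\<Sum>i\<in>I. indicator (?C i) A) \<partial>M)"
    using C by (subst Bochner_Integration.integral_sum) (auto simp: less_top[symmetric])
  \<comment> \<open>Off \<open>T\<close> the drawn algorithm is correct on at most
    \<open>2 ^ mem_bits A < card I / 4\<close> members, so \<open>T\<close> must have probability at
    least 1/2 - 1/4.\<close>
  also have "\<dots> \<le> (\<integral>A. real (card I) * indicator T A + real (card I) / 4 \<partial>M)"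
  proof (intro integral_mono)
    fix A assume A: "A \<in> space M"
    have "(\<Sum>i\<in>I. indicator (?C i) A) = real (card {i \<in> I. correct_on W R \<epsilon> A (f i)})"
      using A assms(3) by (simp add: indicator_def if_distrib sum.If_cases Int_def)
    also have "\<dots> \<le> real (card I) * indicator T A + real (card I) / 4"
    proof (cases "A \<in> T")
      case True
      have "card {i \<in> I. correct_on W R \<epsilon> A (f i)} \<le> card I"
        using assms(3) by (intro card_mono) auto
      then show ?thesis using True by simp
    next
      case False
      then have "4 * card {i \<in> I. correct_on W R \<epsilon> A (f i)} \<le> card I"
        using few[OF A] A by (simp add: T_def)
      then show ?thesis using False by simp
    qed
    finally show "(\<Sum>i\<in>I. indicator (?C i) A) \<le> real (card I) * indicator T A + real (card I) / 4" .
  qed (use C T in \<open>auto simp: less_top[symmetric]\<close>)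
  also have "\<dots> = real (card I) * measure M T + real (card I) / 4"
    using T by (simp add: less_top[symmetric] prob_space)
  finally have "real (card I) * (1 / 4) \<le> real (card I) * measure M T" by simp
  then have "1 / 4 \<le> measure M T" using pos by (simp only: mult_le_cancel_left_pos of_nat_0_less_iff)
  then show ?thesis using expected_bits_ge[OF ra _ pos] by (simp add: T_def)
qed

section \<open>Block words\<close>

text \<open>Holding a letter for \<open>B\<close> steps makes distinct letters contribute sums at
  least \<open>B * s\<close> apart. Long blocks serve large errors, where \<open>s\<close> is capped
  by \<open>R\<close>; a fine step with \<open>B = 1\<close> serves small ones.\<close>

definition block_word :: "nat \<Rightarrow> nat \<Rightarrow> nat list \<Rightarrow> nat list" where
  "block_word B s v = concat (map (\<lambda>a. replicate B (a * s)) v)"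

lemma block_word_append: "block_word B s (u @ v) = block_word B s u @ block_word B s v"
  and block_word_Cons: "block_word B s (a # v) = replicate B (a * s) @ block_word B s v"
  by (simp_all add: block_word_def)

lemma length_block_word: "length (block_word B s v) = length v * B"
  by (induction v) (simp_all add: block_word_def)

lemma input_stream_block_word:
  "(\<And>a. a \<in> set v \<Longrightarrow> a * s \<le> R) \<Longrightarrow> input_stream R (block_word B s v)"
  by (auto simp: input_stream_def block_word_def)

text \<open>The zeros push the window forward until it starts at the last block in which the words
  differ. Everything behind that block agrees, so the sums differ by a nonzero multiple of
  \<open>B * s\<close>.\<close>

lemma config_block_word_inj:
  assumes corr: "correct_on W R \<epsilon> A (block_word B s v @ replicate W 0)"
    and corr': "correct_on W R \<epsilon> A (block_word B s v' @ replicate W 0)"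
    and len: "length v = length v'" "length v * B \<le> W" and "v \<noteq> v'"
    and gap: "2 * (real R * real W * \<epsilon>) < real (B * s)" and "0 < B"
  shows "config A (block_word B s v) \<noteq> config A (block_word B s v')"
proof
  assume eq: "config A (block_word B s v) = config A (block_word B s v')"
  \<comment> \<open>Reversal turns the first difference given by
    \<open>same_length_different\<close> into the last one.\<close>
  have "rev v \<noteq> rev v'" "length (rev v) = length (rev v')" using len \<open>v \<noteq> v'\<close> by simp_all
  then obtain u a p a' p' where "a \<noteq> a'" "rev v = u @ [a] @ p" "rev v' = u @ [a'] @ p'"
    using same_length_different by blast
  then have v: "v = rev p @ a # rev u" and v': "v' = rev p' @ a' # rev u"
    by (simp_all add: rev_swap)
  \<comment> \<open>With \<open>j\<close> zeros the window consists exactly of the block of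
    \<open>a\<close>, the common suffix and the zeros. The subtraction does not truncate, since the
    whole word fits into \<open>W\<close>.\<close>
  define j where "j = W - length (block_word B s (a # rev u))"
  have "(length u + 1) * B \<le> length v * B" by (intro mult_right_mono) (simp_all add: v)
  then have j: "(length u + 1) * B + j = W" "j \<le> W"
    using len(2) by (simp_all add: j_def length_block_word)
  have split: "x @ replicate W 0 = (x @ replicate j 0) @ replicate (W - j) (0::nat)" for x
    using j(2) by (simp flip: replicate_add)
  have sum: "window_sum W (block_word B s (q @ b # rev u) @ replicate j 0)
      = B * (b * s) + sum_list (block_word B s (rev u))" for q b
  proof -
    have "window_sum W (block_word B s q @ (block_word B s (b # rev u) @ replicate j 0))
        = sum_list (block_word B s (b # rev u) @ replicate j 0)"
      using j(1) by (intro window_sum_append) (simp add: length_block_word)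
    then show ?thesis
      by (simp add: block_word_append block_word_Cons sum_list_replicate)
  qed
  have ne: "block_word B s v \<noteq> []" "block_word B s v' \<noteq> []"
    using \<open>0 < B\<close> by (auto simp: v v' simp flip: length_greater_0_conv simp: length_block_word)
  have "\<bar>real (window_sum W (block_word B s v @ replicate j 0))
      - real (window_sum W (block_word B s v' @ replicate j 0))\<bar> \<le> 2 * (real R * real W * \<epsilon>)"
    using corr corr' ne by (intro window_sums_close[where A = A])
      (auto simp only: split intro: config_append_cong[OF eq])
  then have "\<bar>real (B * s) * (real a - real a')\<bar> < real (B * s)"
    using gap by (simp add: v v' sum algebra_simps)
  moreover have "1 \<le> \<bar>real a - real a'\<bar>" using \<open>a \<noteq> a'\<close> by linarith
  then have "real (B * s) * 1 \<le> real (B * s) * \<bar>real a - real a'\<bar>"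
    by (intro mult_left_mono) simp_all
  ultimately show False by (simp add: abs_mult)
qed

text \<open>The family consists of the \<open>n ^ k\<close> words of length \<open>k\<close> over
  \<open>n\<close> letters, each worth \<open>log 2 n\<close> bits per letter.\<close>

lemma expected_bits_ge_block_words:
  assumes mc: "monte_carlo W R \<epsilon> \<delta> M" and "\<delta> \<le> 1 / 2" and "0 < n"
    and range: "\<And>a. a < n \<Longrightarrow> a * s \<le> R" and "k * B \<le> W" and "0 < B"
    and gap: "2 * (real R * real W * \<epsilon>) < real (B * s)"
  shows "ennreal ((real k * log 2 (real n) - 2) / 4) \<le> expected_bits M"
proof -
  define I where "I = {v. set v \<subseteq> {..<n} \<and> length v = k}"
  have I: "finite I" "card I = n ^ k"
    using card_lists_length_eq[of "{..<n}" k] finite_lists_length_eq[of "{..<n}" k]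
    by (simp_all add: I_def)
  have stream: "input_stream R (block_word B s v)" if "v \<in> I" for v
    using that range by (intro input_stream_block_word) (auto simp: I_def)
  have "I \<noteq> {}" using I(2) \<open>0 < n\<close> by auto
  have "ennreal ((log 2 (real (card I)) - 2) / 4) \<le> expected_bits M"
  proof (rule expected_bits_ge_family[OF mc \<open>\<delta> \<le> 1 / 2\<close> I(1) \<open>I \<noteq> {}\<close>])
    show "input_stream R (block_word B s v @ replicate W 0)" if "v \<in> I" for v
      using stream[OF that] by simp
  next
    fix A assume "A \<in> space M"
    then have wf: "well_formed R A" using mc by (simp add: monte_carlo_def randomized_alg_def)
    let ?J = "{v \<in> I. correct_on W R \<epsilon> A (block_word B s v @ replicate W 0)}"
    have "config A (block_word B s v) \<noteq> config A (block_word B s v')"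
      if "v \<in> ?J" "v' \<in> ?J" "v \<noteq> v'" for v v'
      using that \<open>k * B \<le> W\<close>
      by (intro config_block_word_inj[OF _ _ _ _ _ gap \<open>0 < B\<close>]) (simp_all add: I_def)
    then have "inj_on (\<lambda>v. config A (block_word B s v)) ?J"
      unfolding inj_on_def by blast
    then have "card ?J \<le> card {q :: bool list. length q = mem_bits A}"
      using stream length_config[OF wf] finite_configs by (intro card_inj_on_le) auto
    then show "card ?J \<le> 2 ^ mem_bits A" by (simp add: card_configs)
  qed
  then show ?thesis using \<open>0 < n\<close> by (simp add: I(2) log_nat_power)
qed

section \<open>The logarithmic term\<close>

text \<open>On constant input the configurations are the orbit of a single map, so one repetition
  makes the orbit periodic.\<close>

lemma config_periodic:
  assumes "config A (xs @ replicate i 0) = config A (xs @ replicate (i + p) 0)"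
  shows "config A (xs @ replicate (i + r * p) 0) = config A (xs @ replicate i 0)"
proof (induction r)
  case 0
  then show ?case by simp
next
  case (Suc r)
  have "config A (xs @ replicate (i + Suc r * p) 0)
      = config A ((xs @ replicate (i + p) 0) @ replicate (r * p) 0)"
    by (simp add: add.assoc flip: replicate_add)
  also have "\<dots> = config A ((xs @ replicate i 0) @ replicate (r * p) 0)"
    by (intro config_append_cong assms[symmetric])
  also have "\<dots> = config A (xs @ replicate i 0)"
    using Suc by (simp flip: replicate_add)
  finally show ?case .
qed

text \<open>Otherwise one configuration occurs both when the sum is at least
  \<open>3/4 * W * R\<close> and when it is 0, while the error permits a difference of at most
  \<open>W * R / 2\<close>.\<close>

lemma bits_ge_of_correct_on_decay:
  assumes wf: "well_formed R A" and "0 < R" and "0 < W" and "\<epsilon> \<le> 1 / 4"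
    and corr: "correct_on W R \<epsilon> A (replicate W R @ replicate (W + W * W) 0)"
  shows "W \<le> 4 * 2 ^ mem_bits A"
proof (rule ccontr)
  assume "\<not> W \<le> 4 * 2 ^ mem_bits A"
  then have small: "4 * 2 ^ mem_bits A < W" by simp
  let ?x = "\<lambda>i. replicate W R @ replicate i (0::nat)"
  let ?c = "\<lambda>i. config A (?x i)"
  \<comment> \<open>Pigeonhole: the index set has \<open>2 ^ mem_bits A + 1\<close>
    elements.\<close>
  have "\<not> inj_on ?c {..2 ^ mem_bits A}"
  proof
    assume "inj_on ?c {..2 ^ mem_bits A}"
    then have "card {..(2::nat) ^ mem_bits A} \<le> card {q :: bool list. length q = mem_bits A}"
      using length_config[OF wf] finite_configs by (intro card_inj_on_le) auto
    then show False by (simp add: card_configs)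
  qed
  then obtain i i' where i: "i < i'" "i' \<le> 2 ^ mem_bits A" "?c i = ?c i'"
    unfolding inj_on_def by (metis atMost_iff linorder_neq_iff)
  define p where "p = i' - i"
  have p: "1 \<le> p" "p \<le> W" "4 * i \<le> W" using i small by (auto simp: p_def)
  \<comment> \<open>After \<open>W\<close> periods at least \<open>W\<close> zeros have been read,
    so every \<open>R\<close> has expired; \<open>p \<le> W\<close> keeps \<open>l\<close> within
    the stream.\<close>
  define l where "l = i + W * p"
  have "W * 1 \<le> W * p" "W * p \<le> W * W" by (intro mult_le_mono2 p)+
  then have l: "W \<le> l" "l \<le> W + W * W" using p(3) unfolding l_def by linarith+
  have split: "?x (W + W * W) = ?x k @ replicate (W + W * W - k) 0" if "k \<le> W + W * W" for k
    using that by (simp flip: replicate_add)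
  have i_le: "i \<le> W + W * W" using p(3) by simp
  have "?c l = ?c i"
    using i config_periodic[of A "replicate W R" i p W] by (simp add: p_def l_def)
  then have "\<bar>real (window_sum W (?x l)) - real (window_sum W (?x i))\<bar>
      \<le> 2 * (real R * real W * \<epsilon>)"
    using \<open>0 < W\<close> corr[unfolded split[OF l(2)]] corr[unfolded split[OF i_le]]
    by (intro window_sums_close) simp_all
  moreover have "window_sum W (?x l) = 0"
    using l(1) by (simp add: window_sum_def sum_list_replicate)
  moreover have "window_sum W (?x i) = (W - i) * R"
    using p(3) by (simp add: window_sum_def sum_list_replicate)
  ultimately have "real (W - i) * real R \<le> 2 * (real R * real W * \<epsilon>)" by simp
  also have "\<dots> \<le> 2 * (real R * real W * (1 / 4))"
    using \<open>\<epsilon> \<le> 1 / 4\<close> by (intro mult_left_mono) simp_all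
  also have "\<dots> = (real W / 2) * real R" by simp
  finally have "real (W - i) \<le> real W / 2" using \<open>0 < R\<close> by simp
  moreover have "3 * W \<le> 4 * (W - i)" using p(3) by simp
  ultimately show False using \<open>0 < W\<close> by linarith
qed

lemma expected_bits_ge_log_window:
  assumes mc: "monte_carlo W R \<epsilon> \<delta> M" and "\<delta> \<le> 1 / 2" and "0 < R" and "0 < W" and "\<epsilon> \<le> 1 / 4"
  shows "ennreal ((log 2 (real W) - 2) / 4) \<le> expected_bits M"
proof -
  have ra: "randomized_alg R M" using mc by (simp add: monte_carlo_def)
  interpret prob_space M using ra by (simp add: randomized_alg_def)
  have [measurable]: "mem_bits \<in> M \<rightarrow>\<^sub>M count_space UNIV"
    using ra by (simp add: randomized_alg_def)
  let ?x = "replicate W R @ replicate (W + W * W) 0"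
  have "1 - \<delta> \<le> measure M {A \<in> space M. correct_on W R \<epsilon> A ?x}"
    using mc by (simp add: monte_carlo_def)
  also have "\<dots> \<le> measure M {A \<in> space M. W \<le> 4 * 2 ^ mem_bits A}"
  proof (rule finite_measure_mono)
    show "{A \<in> space M. correct_on W R \<epsilon> A ?x} \<subseteq> {A \<in> space M. W \<le> 4 * 2 ^ mem_bits A}"
      using bits_ge_of_correct_on_decay[OF _ assms(3-5)] ra by (auto simp: randomized_alg_def)
  qed measurable
  finally show ?thesis using \<open>\<delta> \<le> 1 / 2\<close> by (intro expected_bits_ge[OF ra _ \<open>0 < W\<close>]) simp
qed

section \<open>The two ranges of the error parameter\<close>

text \<open>Binary words over the values 0 and \<open>R\<close> give one bit for each of about
  \<open>1 / \<epsilon>\<close> blocks; the logarithmic term is supplied by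
  \<open>expected_bits_ge_log_window\<close>.\<close>

lemma expected_bits_ge_large_error:
  assumes mc: "monte_carlo W R \<epsilon> \<delta> M" and "\<delta> \<le> 1 / 2" and "0 < R" and "256 \<le> W"
    and \<epsilon>: "1 / (2 * real W) \<le> \<epsilon>" "\<epsilon> \<le> 1 / 4"
  shows "ennreal (1 / 128 * (1 / \<epsilon> + log 2 (real W))) \<le> expected_bits M"
proof -
  have pos: "0 < real W" "0 < \<epsilon>" using \<epsilon>(1) \<open>256 \<le> W\<close> by (auto intro: less_le_trans[rotated])
  have one: "1 \<le> 2 * real W * \<epsilon>" using \<epsilon>(1) pos by (simp add: field_simps)
  \<comment> \<open>The least integer strictly above \<open>2 * W * \<epsilon>\<close>; since that
    number is at least 1, rounding at most doubles it.\<close>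
  define B where "B = nat \<lfloor>2 * real W * \<epsilon>\<rfloor> + 1"
  define k where "k = W div B"
  have B: "2 * real W * \<epsilon> < real B" "real B \<le> 4 * real W * \<epsilon>"
    using one unfolding B_def by linarith+
  \<comment> \<open>The blocks cover at least half of the window, because the remainder is shorter
    than one block and at least one block fits.\<close>
  have "real W \<le> real (2 * (k * B))"
  proof -
    have "real B \<le> 4 * real W * (1 / 4)"
      using B(2) \<epsilon>(2) mult_left_mono[OF \<epsilon>(2), of "4 * real W"] by simp
    then have "B \<le> W" by simp
    then have "1 \<le> k" by (simp add: k_def B_def div_greater_zero_iff Suc_leI)
    then have "B \<le> k * B" by simp
    moreover have "W = k * B + W mod B" by (simp only: k_def div_mult_mod_eq)
    moreover have "W mod B < B" by (simp add: B_def)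
    ultimately have "W \<le> 2 * (k * B)" by linarith
    then show ?thesis by (simp only: of_nat_le_iff)
  qed
  also have "\<dots> = 2 * real k * real B" by simp
  also have "\<dots> \<le> 2 * real k * (4 * real W * \<epsilon>)" using B(2) by (intro mult_left_mono) simp_all
  also have "\<dots> = real W * (8 * real k * \<epsilon>)" by simp
  finally have "1 \<le> 8 * real k * \<epsilon>"
    using pos(1) by simp
  then have k: "1 / \<epsilon> \<le> 8 * real k" using pos(2) by (simp add: field_simps)
  have "ennreal ((real k * log 2 (real 2) - 2) / 4) \<le> expected_bits M"
  proof (rule expected_bits_ge_block_words[OF mc \<open>\<delta> \<le> 1 / 2\<close>, where B = B and s = R])
    show "2 * (real R * real W * \<epsilon>) < real (B * R)"
      using mult_strict_right_mono[OF B(1), of "real R"] \<open>0 < R\<close> by (simp add: algebra_simps)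
    show "k * B \<le> W" by (simp add: k_def)
    show "a * R \<le> R" if "a < 2" for a using that by (cases a) simp_all
  qed (simp_all add: B_def)
  then have k_bits: "ennreal ((real k - 2) / 4) \<le> expected_bits M" by simp
  have W_bits: "ennreal ((log 2 (real W) - 2) / 4) \<le> expected_bits M"
    using assms by (intro expected_bits_ge_log_window[OF mc]) simp_all
  have "log 2 (2 ^ 8) \<le> log 2 (real W)" using \<open>256 \<le> W\<close> by (subst log_le_cancel_iff) simp_all
  then have "8 \<le> log 2 (real W)" by (subst (asm) log_nat_power) simp_all
  \<comment> \<open>The larger of the two bounds dominates the scaled sum;
    \<open>log 2 W \<ge> 8\<close> absorbs the losses of 2.\<close>
  then have "1 / 128 * (1 / \<epsilon> + log 2 (real W)) \<le> (real k - 2) / 4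
      \<or> 1 / 128 * (1 / \<epsilon> + log 2 (real W)) \<le> (log 2 (real W) - 2) / 4"
    using k by argo
  then show ?thesis using k_bits W_bits by (meson ennreal_leI order_trans)
qed

text \<open>The lower limit on \<open>\<epsilon>\<close> reflects a real barrier: for fixed
  \<open>R\<close> and \<open>W\<close>, storing the window exactly takes a fixed number of bits,
  while the bound grows without limit as \<open>\<epsilon>\<close> tends to 0.\<close>

lemma expected_bits_ge_small_error:
  assumes mc: "monte_carlo W R \<epsilon> \<delta> M" and "\<delta> \<le> 1 / 2" and "0 < R" and "256 \<le> W"
    and \<epsilon>: "1 / (2 * real R * real W) \<le> \<epsilon>" "\<epsilon> \<le> 1 / (2 * real W)"
  shows "ennreal (1 / 128 * (real W * log 2 (1 / (real W * \<epsilon>)))) \<le> expected_bits M"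
proof -
  define L where "L = 1 / (real W * \<epsilon>)"
  have W: "0 < real W" and R: "0 < real R" using \<open>256 \<le> W\<close> \<open>0 < R\<close> by simp_all
  have "0 < 1 / (2 * real R * real W)" using W R by simp
  with \<epsilon>(1) have "0 < \<epsilon>" by linarith
  have "0 < L" using W \<open>0 < \<epsilon>\<close> by (simp add: L_def)
  have "ennreal (1 / 128 * (real W * log 2 L)) \<le> expected_bits M"
  proof (cases "L \<le> 16")
    case True
    \<comment> \<open>Here \<open>log 2 L \<le> 4\<close>, so a bound linear in \<open>W\<close>
      suffices. Blocks of length 2 keep the gap strict at the endpoint
      \<open>\<epsilon> = 1 / (2 * W)\<close>.\<close>
    have bits: "ennreal ((real (W div 2) * log 2 (real 2) - 2) / 4) \<le> expected_bits M"
    proof (rule expected_bits_ge_block_words[OF mc \<open>\<delta> \<le> 1 / 2\<close>, where B = 2 and s = R])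
      have "real W * \<epsilon> \<le> 1 / 2" using \<epsilon>(2) W by (simp add: field_simps)
      then have "real R * (real W * \<epsilon>) \<le> real R * (1 / 2)" using R by (intro mult_left_mono) simp_all
      then have "2 * (real R * real W * \<epsilon>) \<le> real R" by simp
      then show "2 * (real R * real W * \<epsilon>) < real (2 * R)" using R by simp
      show "a * R \<le> R" if "a < 2" for a using that by (cases a) simp_all
    qed simp_all
    have "log 2 L \<le> log 2 (2 ^ 4)"
      using True \<open>0 < L\<close> by (subst log_le_cancel_iff) simp_all
    then have "log 2 L \<le> 4" by (subst (asm) log_nat_power) simp_all
    then have "real W * log 2 L \<le> real W * 4" using W by (intro mult_left_mono) simp_all
    moreover have "real W \<le> 2 * real (W div 2) + 1" "256 \<le> real W"
      using \<open>256 \<le> W\<close> by linarith+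
    ultimately have "1 / 128 * (real W * log 2 L) \<le> (real (W div 2) - 2) / 4"
      by argo
    then have "ennreal (1 / 128 * (real W * log 2 L)) \<le> ennreal ((real (W div 2) - 2) / 4)"
      by (rule ennreal_leI)
    with bits show ?thesis by simp
  next
    case False
    define D where "D = real R * real W * \<epsilon>"
    have "1 \<le> 2 * D" using \<epsilon>(1) W R by (simp add: D_def field_simps)
    \<comment> \<open>The least integer step above twice the error; the lower limit on
      \<open>\<epsilon>\<close> gives \<open>2 * D \<ge> 1\<close>, hence
      \<open>s \<le> 4 * D\<close>. Then \<open>n\<close> counts the multiples of \<open>s\<close>
      in \<open>{0..R}\<close>.\<close>
    define s where "s = nat \<lfloor>2 * D\<rfloor> + 1"
    define n where "n = R div s + 1"
    have "0 < n" by (simp add: n_def)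
    have s: "2 * D < real s" "real s \<le> 4 * D" "0 < s"
      using \<open>1 \<le> 2 * D\<close> unfolding s_def by linarith+
    have "R < n * s"
      using dividend_less_times_div[OF \<open>0 < s\<close>, of R] by (simp add: n_def algebra_simps)
    then have "real R < real n * real s" by (metis of_nat_less_iff of_nat_mult)
    also have "\<dots> \<le> real n * (4 * D)" using s(2) by (intro mult_left_mono) simp_all
    also have "\<dots> = real R * (4 * real n * (real W * \<epsilon>))" by (simp add: D_def)
    finally have "1 < 4 * real n * (real W * \<epsilon>)" using R by simp
    then have n: "L \<le> 4 * real n" using W \<open>0 < \<epsilon>\<close> by (simp add: L_def field_simps)
    have "ennreal ((real W * log 2 (real n) - 2) / 4) \<le> expected_bits M"
    proof (rule expected_bits_ge_block_words[OF mc \<open>\<delta> \<le> 1 / 2\<close>, where B = 1 and s = s])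
      show "a * s \<le> R" if "a < n" for a
        using that \<open>0 < s\<close> by (simp add: n_def less_Suc_eq_le less_eq_div_iff_mult_less_eq)
      show "2 * (real R * real W * \<epsilon>) < real (1 * s)" using s(1) by (simp add: D_def)
    qed (simp_all add: n_def)
    moreover have "log 2 L \<le> log 2 (4 * real n)"
      using n \<open>0 < L\<close> by (subst log_le_cancel_iff) (simp_all add: n_def)
    moreover have "log 2 4 = (2 :: real)" using log_nat_power[of 2 2 2] by simp
    then have "log 2 (4 * real n) = 2 + log 2 (real n)"
      using \<open>0 < n\<close> by (simp add: log_mult)
    moreover have "log 2 (2 ^ 4) \<le> log 2 L"
      using False by (subst log_le_cancel_iff) simp_all
    \<comment> \<open>From \<open>L \<le> 4 * n\<close> one gets
      \<open>log 2 n \<ge> log 2 L - 2\<close>, and this is at least half of \<open>log 2 L\<close>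
      as soon as \<open>log 2 L \<ge> 4\<close>.\<close>
    then have "4 \<le> log 2 L" by (subst (asm) log_nat_power) simp_all
    ultimately have bits: "ennreal ((real W * log 2 (real n) - 2) / 4) \<le> expected_bits M"
      and "log 2 L / 2 \<le> log 2 (real n)" by simp_all
    then have "real W * (log 2 L / 2) \<le> real W * log 2 (real n)" using W by (intro mult_left_mono) simp_all
    moreover have "256 * 4 \<le> real W * log 2 L"
      using \<open>256 \<le> W\<close> \<open>4 \<le> log 2 L\<close> by (intro mult_mono) simp_all
    ultimately have "1 / 128 * (real W * log 2 L) \<le> (real W * log 2 (real n) - 2) / 4" by simp
    then show ?thesis using bits by (meson ennreal_leI order_trans)
  qed
  then show ?thesis by (simp only: L_def)
qed

text \<open>Each correctness event is the whole space, hence measurable with probability 1; this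
  transfers the bounds with \<open>\<delta> = 0\<close> to Las Vegas algorithms.\<close>

lemma las_vegas_imp_monte_carlo:
  assumes "las_vegas W R \<epsilon> M"
  shows "monte_carlo W R \<epsilon> 0 M"
proof -
  have ra: "randomized_alg R M" using assms by (simp add: las_vegas_def)
  interpret prob_space M using ra by (simp add: randomized_alg_def)
  have "{A \<in> space M. correct_on W R \<epsilon> A xs} = space M" if "input_stream R xs" for xs
    using assms that by (auto simp: las_vegas_def)
  then show ?thesis using ra by (simp add: monte_carlo_def prob_space)
qed

theorem theorem14:
  fixes \<delta> :: real
  assumes "0 \<le> \<delta>" and "\<delta> < 1 / 2"
  shows "(\<exists>c>0. \<forall>\<^sub>F W in sequentially. \<forall>R\<ge>1. \<forall>\<epsilon>>0. \<forall>M. monte_carlo W R \<epsilon> \<delta> M \<longrightarrow>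
            (1 / (2 * real W) \<le> \<epsilon> \<and> \<epsilon> \<le> 1 / 4 \<longrightarrow>
               expected_bits M \<ge> ennreal (c * (1 / \<epsilon> + log 2 (real W)))) \<and>
            (1 / (2 * real R * real W) \<le> \<epsilon> \<and> \<epsilon> \<le> 1 / (2 * real W) \<longrightarrow>
               expected_bits M \<ge> ennreal (c * (real W * log 2 (1 / (real W * \<epsilon>))))))
       \<and> (\<forall>W R \<epsilon> M. las_vegas W R \<epsilon> M \<longrightarrow> monte_carlo W R \<epsilon> 0 M)"
proof (intro conjI)
  have "\<delta> \<le> 1 / 2" using assms(2) by simp
  show "\<exists>c>0. \<forall>\<^sub>F W in sequentially. \<forall>R\<ge>1. \<forall>\<epsilon>>0. \<forall>M. monte_carlo W R \<epsilon> \<delta> M \<longrightarrow>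
            (1 / (2 * real W) \<le> \<epsilon> \<and> \<epsilon> \<le> 1 / 4 \<longrightarrow>
               expected_bits M \<ge> ennreal (c * (1 / \<epsilon> + log 2 (real W)))) \<and>
            (1 / (2 * real R * real W) \<le> \<epsilon> \<and> \<epsilon> \<le> 1 / (2 * real W) \<longrightarrow>
               expected_bits M \<ge> ennreal (c * (real W * log 2 (1 / (real W * \<epsilon>)))))"
  \<comment> \<open>One constant and one threshold for \<open>W\<close> serve all \<open>R\<close>
    and \<open>\<epsilon>\<close> and both error ranges.\<close>
  proof (intro exI[of _ "1 / 128"] conjI eventually_mono[OF eventually_ge_at_top[of 256]] allI impI)
    show "ennreal (1 / 128 * (1 / \<epsilon> + log 2 (real W))) \<le> expected_bits M"
      if "256 \<le> W" "1 \<le> R" "monte_carlo W R \<epsilon> \<delta> M" "1 / (2 * real W) \<le> \<epsilon> \<and> \<epsilon> \<le> 1 / 4" for W R \<epsilon> M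
      using that \<open>\<delta> \<le> 1 / 2\<close> by (intro expected_bits_ge_large_error) (simp_all add: Suc_le_eq)
    show "ennreal (1 / 128 * (real W * log 2 (1 / (real W * \<epsilon>)))) \<le> expected_bits M"
      if "256 \<le> W" "1 \<le> R" "monte_carlo W R \<epsilon> \<delta> M"
        "1 / (2 * real R * real W) \<le> \<epsilon> \<and> \<epsilon> \<le> 1 / (2 * real W)" for W R \<epsilon> M
      using that \<open>\<delta> \<le> 1 / 2\<close> by (intro expected_bits_ge_small_error[where R = R]) (auto simp: Suc_le_eq)
  qed simp
  show "\<forall>W R \<epsilon> M. las_vegas W R \<epsilon> M \<longrightarrow> monte_carlo W R \<epsilon> 0 M"
    using las_vegas_imp_monte_carlo by blast
qed

end
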